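(* Let $G$ be a group. If $G$ is pseudocentral, i.e. $G=P(G)$, then $G'=G''$ and $Z_2(G)=Z(G)$. In particular, if a pseudocentral group $G$ is hypocentral, hypoabelian or hypercentral, then $G$ is abelian.
   Context: For a group $G$, the pseudocentre is $P(G)=\bigcap_{x\in G}C_G(x)^G$, where $C_G(x)$ is the centralizer of $x$ in $G$ and, for a subgroup $H\leq G$, $H^G$ is the normal closure of $H$ in $G$. $G'=[G,G]$, $G''=(G')'$; $Z(G)$ is the centre and $Z_2(G)$ the second term of the upper central series. A group is hypercentral if it has an ascending central series (equivalently, its transfinite upper central series reaches $G$), hypocentral if its transfinite lower central series reaches $\{1\}$, and hypoabelian if its transfinite derived series reaches $\{1\}$. *)

theory Defs
  imports "HOL-Algebra.Algebra"
begin

section \<open>Pseudocentral groups\<close>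

definition centralizer :: "('a, 'b) monoid_scheme \<Rightarrow> 'a \<Rightarrow> 'a set"
  where "centralizer G x = {y \<in> carrier G. y \<otimes>\<^bsub>G\<^esub> x = x \<otimes>\<^bsub>G\<^esub> y}"

definition normal_closure :: "('a, 'b) monoid_scheme \<Rightarrow> 'a set \<Rightarrow> 'a set"
  where "normal_closure G H = \<Inter>{N. N \<lhd> G \<and> H \<subseteq> N}"

definition pseudocentre :: "('a, 'b) monoid_scheme \<Rightarrow> 'a set"
  where "pseudocentre G = (\<Inter>x\<in>carrier G. normal_closure G (centralizer G x))"

definition pseudocentral :: "('a, 'b) monoid_scheme \<Rightarrow> bool"
  where "pseudocentral G \<longleftrightarrow> carrier G = pseudocentre G"


section \<open>Upper central series\<close>

definition center :: "('a, 'b) monoid_scheme \<Rightarrow> 'a set"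
  where "center G = {x \<in> carrier G. \<forall>y\<in>carrier G. x \<otimes>\<^bsub>G\<^esub> y = y \<otimes>\<^bsub>G\<^esub> x}"

text \<open>The preimage in \<open>G\<close> of the centre of \<open>G/N\<close>, for \<open>N\<close> normal in \<open>G\<close>.\<close>

definition center_mod :: "('a, 'b) monoid_scheme \<Rightarrow> 'a set \<Rightarrow> 'a set"
  where "center_mod G N = {x \<in> carrier G. N #>\<^bsub>G\<^esub> x \<in> center (G Mod N)}"

primrec upper_central :: "('a, 'b) monoid_scheme \<Rightarrow> nat \<Rightarrow> 'a set"
  where
    "upper_central G 0 = {\<one>\<^bsub>G\<^esub>}"
  | "upper_central G (Suc n) = center_mod G (upper_central G n)"


section \<open>Transfinite series\<close>

text \<open>
  Series are indexed by a well-order \<open>r\<close>, in the non-strict convention of the library.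
  An index \<open>i\<close> is the least one if \<open>underS r i = {}\<close>, it is the successor of \<open>j\<close> if
  \<open>underS r i = under r j\<close>, and it is a limit otherwise.
\<close>

definition transfinite_series ::
    "'i rel \<Rightarrow> 's \<Rightarrow> ('s \<Rightarrow> 's \<Rightarrow> bool) \<Rightarrow> ('s set \<Rightarrow> 's) \<Rightarrow> ('i \<Rightarrow> 's) \<Rightarrow> bool"
  where "transfinite_series r start step at_lim S \<longleftrightarrow>
    Well_order r \<and>
    (\<forall>i\<in>Field r.
      (underS r i = {} \<longrightarrow> S i = start) \<and>
      (\<forall>j\<in>Field r. underS r i = under r j \<longrightarrow> step (S j) (S i)) \<and>
      (underS r i \<noteq> {} \<and> \<not> (\<exists>j\<in>Field r. underS r i = under r j) \<longrightarrow> S i = at_lim (S ` underS r i)))"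

definition commutator_subgroup :: "('a, 'b) monoid_scheme \<Rightarrow> 'a set \<Rightarrow> 'a set \<Rightarrow> 'a set"
  where "commutator_subgroup G H K =
    generate G (\<Union>h\<in>H. \<Union>k\<in>K. {h \<otimes>\<^bsub>G\<^esub> k \<otimes>\<^bsub>G\<^esub> inv\<^bsub>G\<^esub> h \<otimes>\<^bsub>G\<^esub> inv\<^bsub>G\<^esub> k})"

definition lower_central_series ::
    "('a, 'b) monoid_scheme \<Rightarrow> 'i rel \<Rightarrow> ('i \<Rightarrow> 'a set) \<Rightarrow> bool"
  where "lower_central_series G r S \<longleftrightarrow>
    transfinite_series r (carrier G) (\<lambda>H K. K = commutator_subgroup G H (carrier G)) Inter S"

definition derived_series ::
    "('a, 'b) monoid_scheme \<Rightarrow> 'i rel \<Rightarrow> ('i \<Rightarrow> 'a set) \<Rightarrow> bool"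
  where "derived_series G r S \<longleftrightarrow>
    transfinite_series r (carrier G) (\<lambda>H K. K = derived G H) Inter S"

text \<open>
  In an ascending central series every factor \<open>K/H\<close> of consecutive terms lies in the centre
  of \<open>G/H\<close>.
\<close>

definition ascending_central_series ::
    "('a, 'b) monoid_scheme \<Rightarrow> 'i rel \<Rightarrow> ('i \<Rightarrow> 'a set) \<Rightarrow> bool"
  where "ascending_central_series G r S \<longleftrightarrow>
    transfinite_series r {\<one>\<^bsub>G\<^esub>}
      (\<lambda>H K. H \<lhd> G \<and> K \<lhd> G \<and> H \<subseteq> K \<and> K \<subseteq> center_mod G H) Union S"

text \<open>
  A definition cannot quantify over all index types. Indexing by the subsets of the group type
  loses nothing, because a series can be indexed by its own terms; the lemmas
  \<open>hypocentralI\<close>, \<open>hypoabelianI\<close> and \<open>hypercentralI\<close> below accept an arbitrary index type.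
\<close>

definition hypocentral :: "('a, 'b) monoid_scheme \<Rightarrow> bool"
  where "hypocentral G \<longleftrightarrow>
    (\<exists>(r :: 'a set rel) S. lower_central_series G r S \<and> (\<exists>i\<in>Field r. S i = {\<one>\<^bsub>G\<^esub>}))"

definition hypoabelian :: "('a, 'b) monoid_scheme \<Rightarrow> bool"
  where "hypoabelian G \<longleftrightarrow>
    (\<exists>(r :: 'a set rel) S. derived_series G r S \<and> (\<exists>i\<in>Field r. S i = {\<one>\<^bsub>G\<^esub>}))"

definition hypercentral :: "('a, 'b) monoid_scheme \<Rightarrow> bool"
  where "hypercentral G \<longleftrightarrow>
    (\<exists>(r :: 'a set rel) S. ascending_central_series G r S \<and> (\<exists>i\<in>Field r. S i = carrier G))"


section \<open>Independence of the index type\<close>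

lemma reindex_by_terms:
  fixes r :: "'i rel" and S :: "'i \<Rightarrow> 's"
  assumes series: "transfinite_series r start step at_lim S"
    and refl: "\<And>A. below A A"
    and trans: "\<And>A B C. below A B \<Longrightarrow> below B C \<Longrightarrow> below A C"
    and antisym: "\<And>A B. below A B \<Longrightarrow> below B A \<Longrightarrow> A = B"
    and lim_upper: "\<And>Y A. A \<in> Y \<Longrightarrow> below A (at_lim Y)"
    and lim_max: "\<And>Y A. A \<in> Y \<Longrightarrow> (\<And>B. B \<in> Y \<Longrightarrow> below B A) \<Longrightarrow> at_lim Y = A"
    and inv_start: "P start"
    and inv_step: "\<And>A B. P A \<Longrightarrow> step A B \<Longrightarrow> P B \<and> below A B"
    and inv_lim: "\<And>Y. Y \<noteq> {} \<Longrightarrow> (\<And>A. A \<in> Y \<Longrightarrow> P A) \<Longrightarrow> P (at_lim Y)"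
  defines "q \<equiv> {(A, B). A \<in> S ` Field r \<and> B \<in> S ` Field r \<and> below A B}"
  shows "transfinite_series q start step at_lim (\<lambda>A. A) \<and> Field q = S ` Field r"
proof -
  have wo: "Well_order r"
    and start: "\<And>i. i \<in> Field r \<Longrightarrow> underS r i = {} \<Longrightarrow> S i = start"
    and step: "\<And>i j. i \<in> Field r \<Longrightarrow> j \<in> Field r \<Longrightarrow> underS r i = under r j \<Longrightarrow> step (S j) (S i)"
    and at_lim: "\<And>i. i \<in> Field r \<Longrightarrow> underS r i \<noteq> {} \<Longrightarrow>
      \<not> (\<exists>j\<in>Field r. underS r i = under r j) \<Longrightarrow> S i = at_lim (S ` underS r i)"
    using series unfolding transfinite_series_def by blast+
  have W: "wo_rel r" by unfold_locales (rule wo)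
  note REFL = wo_rel.REFL[OF W] and ANTISYM = wo_rel.ANTISYM[OF W] and WF = wo_rel.WF[OF W]
    and TOTALS = wo_rel.TOTALS[OF W]
    and minim_in = wo_rel.minim_in[OF W] and minim_least = wo_rel.minim_least[OF W]
  have refl_r: "(i, i) \<in> r" if "i \<in> Field r" for i
    using REFL that by (auto simp: refl_on_def)
  have antisym_r: "i = j" if "(i, j) \<in> r" "(j, i) \<in> r" for i j
    using ANTISYM that by (auto simp: antisym_def)
  have mono_inv: "P (S i) \<and> (\<forall>k. (k, i) \<in> r \<longrightarrow> below (S k) (S i))" if "i \<in> Field r" for i
    using WF that
  proof (induction i rule: wf_induct_rule)
    case (less i)
    have IH: "P (S k)" "(l, k) \<in> r \<Longrightarrow> below (S l) (S k)" if "k \<in> underS r i" for k l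
      using less.IH[of k] that by (auto simp: underS_def Field_def)
    have un: "k = i \<or> k \<in> underS r i" if "(k, i) \<in> r" for k
      using that by (auto simp: underS_def)
    consider "underS r i = {}" | j where "j \<in> Field r" "underS r i = under r j"
      | "underS r i \<noteq> {}" "\<not> (\<exists>j\<in>Field r. underS r i = under r j)" by blast
    then show ?case
    proof cases
      case 1
      then show ?thesis using start[OF less.prems] inv_start un refl by auto
    next
      case (2 j)
      have j: "j \<in> underS r i" using 2 refl_r by (auto simp: under_def)
      have s: "P (S i)" "below (S j) (S i)"
        using inv_step[OF IH(1)[OF j] step[OF less.prems 2]] by auto
      have "below (S k) (S i)" if "(k, i) \<in> r" for k
        using un[OF that]
      proof
        assume "k \<in> underS r i"
        then have "(k, j) \<in> r" using 2 by (auto simp: under_def)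
        then show ?thesis using IH(2)[OF j] trans s by blast
      qed (simp add: refl)
      then show ?thesis using s by blast
    next
      case 3
      have e: "S i = at_lim (S ` underS r i)" by (rule at_lim[OF less.prems 3])
      have "P (S i)" unfolding e by (rule inv_lim) (use 3 IH in auto)
      moreover have "below (S k) (S i)" if "(k, i) \<in> r" for k
        using un[OF that] lim_upper[of "S k" "S ` underS r i"] e refl by auto
      ultimately show ?thesis by blast
    qed
  qed
  then have mono: "below (S k) (S i)" if "(k, i) \<in> r" for k i
    using that by (auto simp: Field_def)
  have Fq: "Field q = S ` Field r"
    unfolding q_def Field_def using refl by blast
  have least: "\<exists>i\<in>Field r. S i \<in> Q \<and> (\<forall>k\<in>Field r. S k \<in> Q \<longrightarrow> (i, k) \<in> r)"
    if "A \<in> Q" "A \<in> S ` Field r" for Q A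
  proof -
    let ?B = "{i \<in> Field r. S i \<in> Q}"
    have B: "?B \<subseteq> Field r" "?B \<noteq> {}" using that by auto
    show ?thesis using minim_in[OF B] minim_least[OF B(1)] by blast
  qed
  have total: "below A B \<or> below B A" if "A \<in> S ` Field r" "B \<in> S ` Field r" for A B
    using that TOTALS mono by blast
  have woq: "Well_order q"
    unfolding well_order_on_def linear_order_on_def partial_order_on_def preorder_on_def Fq
  proof (intro conjI)
    show "q \<subseteq> S ` Field r \<times> S ` Field r" "refl_on (S ` Field r) q"
      using refl by (auto simp: q_def refl_on_def)
    show "Relation.trans q" using trans unfolding q_def trans_def by blast
    show "antisym q" using antisym unfolding q_def antisym_def by blast
    show "total_on (S ` Field r) q" using total by (auto simp: q_def total_on_def)
    show "wf (q - Id)"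
    proof (rule wfI_min)
      fix A Q assume A: "(A :: 's) \<in> Q"
      show "\<exists>z\<in>Q. \<forall>y. (y, z) \<in> q - Id \<longrightarrow> y \<notin> Q"
      proof (cases "A \<in> S ` Field r")
        case False
        then show ?thesis using A by (auto simp: q_def)
      next
        case True
        from least[OF A True] obtain i where i: "S i \<in> Q"
            "\<forall>k\<in>Field r. S k \<in> Q \<longrightarrow> (i, k) \<in> r" by blast
        have "y \<notin> Q" if y: "(y, S i) \<in> q - Id" for y
        proof
          assume "y \<in> Q"
          moreover obtain k where k: "k \<in> Field r" "y = S k" "below (S k) (S i)" "S k \<noteq> S i"
            using y by (auto simp: q_def)
          ultimately have "(i, k) \<in> r" using i(2) by blast
          then show False using mono[of i k] antisym[of "S k" "S i"] k by simp
        qed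
        then show ?thesis using i(1) by blast
      qed
    qed
  qed
  have main: "(underS q A = {} \<longrightarrow> A = start) \<and>
      (\<forall>B\<in>Field q. underS q A = under q B \<longrightarrow> step B A) \<and>
      (underS q A \<noteq> {} \<and> \<not> (\<exists>B\<in>Field q. underS q A = under q B) \<longrightarrow> A = at_lim (underS q A))"
    if "A \<in> Field q" for A
  proof -
    have AF: "A \<in> S ` Field r" using that Fq by simp
    obtain i where i: "i \<in> Field r" "A = S i" "\<forall>k\<in>Field r. S k = A \<longrightarrow> (i, k) \<in> r"
      using least[of A "{A}"] AF by auto
    have "underS q A \<subseteq> S ` underS r i"
    proof
      fix B assume "B \<in> underS q A"
      then obtain k where k: "k \<in> Field r" "B = S k" "below (S k) (S i)" "S k \<noteq> S i"
        by (auto simp: underS_def q_def i(2))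
      have "(i, k) \<notin> r" using mono antisym k by blast
      then have "k \<in> underS r i" using TOTALS k(1) i(1) k(4) by (auto simp: underS_def)
      then show "B \<in> S ` underS r i" using k(2) by blast
    qed
    moreover have "S ` underS r i \<subseteq> underS q A"
    proof
      fix B assume "B \<in> S ` underS r i"
      then obtain k where k: "B = S k" "(k, i) \<in> r" "k \<noteq> i" by (auto simp: underS_def)
      have kF: "k \<in> Field r" using k(2) by (auto simp: Field_def)
      have "S k \<noteq> A" using i(3) kF k antisym_r by blast
      then show "B \<in> underS q A"
        using mono[OF k(2)] k(1) kF i AF by (auto simp: underS_def q_def)
    qed
    ultimately have U: "underS q A = S ` underS r i" by blast
    have pred: "B = C" if "underS q A = under q B" "B \<in> Field q"
        "C \<in> underS q A" "\<And>D. D \<in> underS q A \<Longrightarrow> below D C" for B C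
    proof (rule antisym)
      have "B \<in> under q B" using that(2) refl by (auto simp: under_def q_def Fq[unfolded q_def])
      then show "below B C" using that(1,4) by blast
      show "below C B" using that(1,3) by (auto simp: under_def q_def)
    qed
    consider "underS r i = {}" | j where "j \<in> Field r" "underS r i = under r j"
      | "underS r i \<noteq> {}" "\<not> (\<exists>j\<in>Field r. underS r i = under r j)" by blast
    then show ?thesis
    proof cases
      case 1
      have "under q B \<noteq> {}" if "B \<in> Field q" for B
        using that refl by (auto simp: under_def q_def Fq[unfolded q_def])
      then show ?thesis using start[OF i(1) 1] 1 U i(2) by (metis image_empty)
    next
      case (2 j)
      have ju: "j \<in> under r j" using 2 refl_r by (auto simp: under_def)
      have Sj: "S j \<in> underS q A" using U 2 ju by blast
      have top: "below D (S j)" if "D \<in> underS q A" for D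
        using that U 2 mono by (auto simp: under_def)
      have "under q (S j) = underS q A"
      proof
        show "underS q A \<subseteq> under q (S j)"
        proof
          fix D assume D: "D \<in> underS q A"
          then show "D \<in> under q (S j)"
            using top[OF D] 2(1) by (auto simp: under_def underS_def q_def)
        qed
        show "under q (S j) \<subseteq> underS q A"
        proof
          fix D assume D: "D \<in> under q (S j)"
          have "below D (S j)" "D \<in> S ` Field r" using D by (auto simp: under_def q_def)
          moreover have "below (S j) A" "S j \<noteq> A" using Sj by (auto simp: underS_def q_def)
          ultimately have "below D A" "D \<noteq> A" using trans antisym by blast+
          then show "D \<in> underS q A" using AF \<open>D \<in> S ` Field r\<close> by (auto simp: underS_def q_def)
        qed
      qed
      moreover have "S j \<in> Field q" using 2 Fq by blast
      ultimately show ?thesis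
        using pred[OF _ _ Sj top] step[OF i(1) 2] i(2) Sj by blast
    next
      case 3
      have e: "A = at_lim (underS q A)" using at_lim[OF i(1) 3] i(2) U by simp
      have False if B: "B \<in> Field q" "underS q A = under q B" for B
      proof -
        have "B \<in> underS q A" using B refl by (auto simp: under_def q_def Fq[unfolded q_def])
        moreover have "below D B" if "D \<in> underS q A" for D
          using that B by (auto simp: under_def q_def)
        ultimately have "at_lim (underS q A) = B" by (rule lim_max)
        with e \<open>B \<in> underS q A\<close> show False by (auto simp: underS_def)
      qed
      then show ?thesis using e 3(1) U by blast
    qed
  qed
  show ?thesis
    unfolding transfinite_series_def using woq main Fq by simp
qed

lemma (in group) commutator_subgroup_normal:
  assumes "H \<lhd> G"
  shows "commutator_subgroup G H (carrier G) \<lhd> G \<and> commutator_subgroup G H (carrier G) \<subseteq> H"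
proof
  let ?C = "\<Union>h\<in>H. \<Union>k\<in>carrier G. {h \<otimes> k \<otimes> inv h \<otimes> inv k}"
  interpret H: normal H G by (rule assms)
  have C: "h \<otimes> k \<otimes> inv h \<otimes> inv k \<in> H" if "h \<in> H" "k \<in> carrier G" for h k
  proof -
    have "h \<otimes> (k \<otimes> inv h \<otimes> inv k) \<in> H"
      using that by (intro H.m_closed H.inv_op_closed2) auto
    then show ?thesis using that H.subset by (simp add: m_assoc subset_iff)
  qed
  then have sub: "?C \<subseteq> H" by blast
  then show "commutator_subgroup G H (carrier G) \<subseteq> H"
    unfolding commutator_subgroup_def by (rule generate_subgroup_incl) (rule H.subgroup_axioms)
  show "commutator_subgroup G H (carrier G) \<lhd> G"
    unfolding commutator_subgroup_def
  proof (rule normal_generateI)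
    show "?C \<subseteq> carrier G" using sub H.subset by blast
    fix c g assume "c \<in> ?C" and g: "g \<in> carrier G"
    then obtain h k where h: "h \<in> H" "h \<in> carrier G" and k: "k \<in> carrier G"
      and c: "c = h \<otimes> k \<otimes> inv h \<otimes> inv k" using H.subset by blast
    let ?h = "g \<otimes> h \<otimes> inv g" and ?k = "g \<otimes> k \<otimes> inv g"
    have cancel: "inv g \<otimes> (g \<otimes> x) = x" if "x \<in> carrier G" for x
      using g that by (simp add: m_assoc[symmetric])
    have "g \<otimes> c \<otimes> inv g = ?h \<otimes> ?k \<otimes> inv ?h \<otimes> inv ?k"
      using g h k by (simp add: c m_assoc inv_mult_group cancel)
    moreover have "?h \<in> H" "?k \<in> carrier G" using g h k H.inv_op_closed2 by auto
    ultimately show "g \<otimes> c \<otimes> inv g \<in> ?C" by blast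
  qed
qed

lemma (in group) hypocentralI:
  fixes r :: "'i rel"
  assumes "lower_central_series G r S" "i \<in> Field r" "S i = {\<one>}"
  shows "hypocentral G"
proof -
  let ?q = "{(A, B). A \<in> S ` Field r \<and> B \<in> S ` Field r \<and> B \<subseteq> A}"
  have "transfinite_series ?q (carrier G) (\<lambda>H K. K = commutator_subgroup G H (carrier G)) Inter (\<lambda>A. A)
      \<and> Field ?q = S ` Field r"
  proof (rule reindex_by_terms[where below = "\<lambda>A B. B \<subseteq> A" and P = "\<lambda>H. H \<lhd> G"])
    show "carrier G \<lhd> G" by (simp add: normal_inv_iff subgroup_self)
    show "\<Inter>Y \<lhd> G" if "Y \<noteq> {}" "\<And>A. A \<in> Y \<Longrightarrow> A \<lhd> G" for Y
      unfolding normal_inv_iff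
      using that subgroups_Inter[of Y] by (auto simp: normal_inv_iff)
    show "B \<lhd> G \<and> B \<subseteq> A" if "A \<lhd> G" "B = commutator_subgroup G A (carrier G)" for A B
      using commutator_subgroup_normal that by simp
  qed (use assms(1)[unfolded lower_central_series_def] in auto)
  then show ?thesis
    unfolding hypocentral_def lower_central_series_def
    using imageI[OF assms(2), of S, unfolded assms(3)]
    by (intro exI[of _ ?q] exI[of _ "\<lambda>A. A"] conjI bexI[of _ "{\<one>}"]) simp_all
qed

lemma (in group) hypoabelianI:
  fixes r :: "'i rel"
  assumes "derived_series G r S" "i \<in> Field r" "S i = {\<one>}"
  shows "hypoabelian G"
proof -
  let ?q = "{(A, B). A \<in> S ` Field r \<and> B \<in> S ` Field r \<and> B \<subseteq> A}"
  have "transfinite_series ?q (carrier G) (\<lambda>H K. K = derived G H) Inter (\<lambda>A. A)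
      \<and> Field ?q = S ` Field r"
  proof (rule reindex_by_terms[where below = "\<lambda>A B. B \<subseteq> A" and P = "\<lambda>H. subgroup H G"])
    show "subgroup (carrier G) G" by (rule subgroup_self)
    show "subgroup (\<Inter>Y) G" if "Y \<noteq> {}" "\<And>A. A \<in> Y \<Longrightarrow> subgroup A G" for Y
      using that by (intro subgroups_Inter) auto
    show "subgroup B G \<and> B \<subseteq> A" if "subgroup A G" "B = derived G A" for A B
      using that by (simp add: derived_is_subgroup derived_incl subgroup.subset)
  qed (use assms(1)[unfolded derived_series_def] in auto)
  then show ?thesis
    unfolding hypoabelian_def derived_series_def
    using imageI[OF assms(2), of S, unfolded assms(3)]
    by (intro exI[of _ ?q] exI[of _ "\<lambda>A. A"] conjI bexI[of _ "{\<one>}"]) simp_all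
qed

lemma hypercentralI:
  fixes r :: "'i rel"
  assumes "ascending_central_series G r S" "i \<in> Field r" "S i = carrier G"
  shows "hypercentral G"
proof -
  let ?q = "{(A, B). A \<in> S ` Field r \<and> B \<in> S ` Field r \<and> A \<subseteq> B}"
  have "ascending_central_series G ?q (\<lambda>A. A) \<and> Field ?q = S ` Field r"
    unfolding ascending_central_series_def
    by (rule reindex_by_terms[where below = "\<lambda>A B. A \<subseteq> B" and P = "\<lambda>_. True"])
      (use assms(1)[unfolded ascending_central_series_def] in auto)
  then show ?thesis
    unfolding hypercentral_def
    using imageI[OF assms(2), of S, unfolded assms(3)]
    by (intro exI[of _ ?q] exI[of _ "\<lambda>A. A"] conjI bexI[of _ "carrier G"]) simp_all
qed

end

theory Submission
  imports Defs
begin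

text \<open>
  In a pseudocentral group the only normal subgroup containing some centralizer
  \<open>C(x)\<close> is \<open>G\<close> itself. For \<open>N\<close> normal, \<open>D x = {g. [x, g] \<in> N}\<close> is a subgroup
  containing \<open>C(x)\<close>, so \<open>D x = G\<close> as soon as \<open>G' \<subseteq> D x\<close>. Take \<open>N = G''\<close>: if \<open>x \<in> G'\<close>, then
  \<open>G' \<subseteq> D x\<close>, hence \<open>[G', G] \<subseteq> G''\<close>; this gives \<open>G' \<subseteq> D x\<close> for every \<open>x\<close>, hence
  \<open>G' \<subseteq> G''\<close>. For \<open>x\<close> in the second centre, \<open>C(x)\<close> is normal, being the kernel of the
  homomorphism \<open>g \<mapsto> [x, g]\<close>, so \<open>x\<close> is central. Consequently the transfinite
  lower central and derived series never descend below \<open>G'\<close>, and an ascending central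
  series never leaves the centre.
\<close>

text \<open>Well-founded induction on the index, with one case per clause of
  \<open>transfinite_series\<close>. Since \<open>P\<close> speaks of terms and not of indices, a
  fixed lower or upper bound for all terms only has to survive \<open>step\<close> and intersections
  or unions.\<close>

lemma transfinite_series_induct [consumes 2, case_names start step at_lim]:
  assumes series: "transfinite_series r start step at_lim S" and i: "i \<in> Field r"
    and start: "P start"
    and step: "\<And>A B. P A \<Longrightarrow> step A B \<Longrightarrow> P B"
    and at_lim: "\<And>Y. Y \<noteq> {} \<Longrightarrow> (\<And>A. A \<in> Y \<Longrightarrow> P A) \<Longrightarrow> P (at_lim Y)"
  shows "P (S i)"
proof -
  have wo: "Well_order r" using series by (simp add: transfinite_series_def)
  then have W: "wo_rel r" by unfold_locales
  show ?thesis
    using wo_rel.WF[OF W] i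
  proof (induction i rule: wf_induct_rule)
    case (less i)
    have IH: "P (S k)" if "k \<in> underS r i" for k
      using less.IH[of k] that by (auto simp: underS_def Field_def)
    consider "underS r i = {}" | j where "j \<in> Field r" "underS r i = under r j"
      | "underS r i \<noteq> {}" "\<not> (\<exists>j\<in>Field r. underS r i = under r j)" by blast
    then show ?case
    proof cases
      case 1
      then show ?thesis using series less.prems start by (simp add: transfinite_series_def)
    next
      case (2 j)
      \<comment> \<open>\<open>under r j\<close> contains \<open>j\<close> by reflexivity, so the
        successor equation puts \<open>j\<close> strictly below \<open>i\<close>.\<close>
      then have "j \<in> underS r i"
        using wo_rel.REFL[OF W] by (auto simp: under_def refl_on_def)
      moreover have "step (S j) (S i)"
        using series less.prems 2 by (simp add: transfinite_series_def)
      ultimately show ?thesis using IH step by blast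
    next
      case 3
      then have "S i = at_lim (S ` underS r i)"
        using series less.prems by (simp add: transfinite_series_def)
      then show ?thesis using at_lim[of "S ` underS r i"] 3 IH by auto
    qed
  qed
qed

text \<open>The preimage in \<open>G\<close> of the centralizer of \<open>Nx\<close> in \<open>G/N\<close>, for \<open>N\<close> normal in \<open>G\<close>.\<close>

definition centralizer_mod :: "('a, 'b) monoid_scheme \<Rightarrow> 'a set \<Rightarrow> 'a \<Rightarrow> 'a set"
  where "centralizer_mod G N x =
    {g \<in> carrier G. x \<otimes>\<^bsub>G\<^esub> g \<otimes>\<^bsub>G\<^esub> inv\<^bsub>G\<^esub> x \<otimes>\<^bsub>G\<^esub> inv\<^bsub>G\<^esub> g \<in> N}"

section \<open>Commutators with a fixed element modulo a normal subgroup\<close>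

context group
begin

lemma inv_cancel_left [simp]:
  assumes "x \<in> carrier G" "y \<in> carrier G"
  shows "inv x \<otimes> (x \<otimes> y) = y" "x \<otimes> (inv x \<otimes> y) = y"
  using assms by (simp_all add: m_assoc[symmetric])

lemma commutator_eq_one_iff:
  assumes "x \<in> carrier G" "y \<in> carrier G"
  shows "x \<otimes> y \<otimes> inv x \<otimes> inv y = \<one> \<longleftrightarrow> x \<otimes> y = y \<otimes> x"
proof -
  have "x \<otimes> y \<otimes> inv x \<otimes> inv y = x \<otimes> y \<otimes> inv (y \<otimes> x)"
    using assms by (simp add: m_assoc inv_mult_group)
  then show ?thesis using assms by (metis inv_closed inv_equality inv_inv m_closed r_inv)
qed

text \<open>Closure rests on [x, gh] = [x, g] g [x, h] g^-1 and [x, g^-1] = g^-1 [x, g]^-1 g;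
  normality of \<open>N\<close> absorbs the conjugations.\<close>

lemma centralizer_mod_subgroup:
  assumes "N \<lhd> G" and x: "x \<in> carrier G"
  shows "subgroup (centralizer_mod G N x) G"
proof -
  interpret N: normal N G by fact
  show ?thesis
  proof
    show "centralizer_mod G N x \<subseteq> carrier G" by (auto simp: centralizer_mod_def)
    show "\<one> \<in> centralizer_mod G N x" using x by (simp add: centralizer_mod_def)
  next
    fix g h assume "g \<in> centralizer_mod G N x" "h \<in> centralizer_mod G N x"
    then have g: "g \<in> carrier G" "x \<otimes> g \<otimes> inv x \<otimes> inv g \<in> N"
      and h: "h \<in> carrier G" "x \<otimes> h \<otimes> inv x \<otimes> inv h \<in> N"
      by (auto simp: centralizer_mod_def)
    have "x \<otimes> (g \<otimes> h) \<otimes> inv x \<otimes> inv (g \<otimes> h)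
        = (x \<otimes> g \<otimes> inv x \<otimes> inv g) \<otimes> (g \<otimes> (x \<otimes> h \<otimes> inv x \<otimes> inv h) \<otimes> inv g)"
      using x g(1) h(1) by (simp add: m_assoc inv_mult_group)
    also have "\<dots> \<in> N" using g h N.inv_op_closed2 by blast
    finally show "g \<otimes> h \<in> centralizer_mod G N x"
      using g h by (simp add: centralizer_mod_def)
  next
    fix g assume "g \<in> centralizer_mod G N x"
    then have g: "g \<in> carrier G" "x \<otimes> g \<otimes> inv x \<otimes> inv g \<in> N"
      by (auto simp: centralizer_mod_def)
    have "x \<otimes> inv g \<otimes> inv x \<otimes> inv (inv g)
        = inv g \<otimes> inv (x \<otimes> g \<otimes> inv x \<otimes> inv g) \<otimes> g"
      using x g(1) by (simp add: m_assoc inv_mult_group)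
    also have "\<dots> \<in> N" using g N.inv_op_closed1 by blast
    finally show "inv g \<in> centralizer_mod G N x"
      using g by (simp add: centralizer_mod_def)
  qed
qed

text \<open>The reason is g h g^-1 = [g, h] h.\<close>

lemma subgroup_above_derived_normal:
  assumes "subgroup H G" and "derived G (carrier G) \<subseteq> H"
  shows "H \<lhd> G"
proof -
  interpret H: subgroup H G by fact
  show ?thesis
    unfolding normal_inv_iff
  proof (intro conjI ballI assms(1))
    fix g h assume g: "g \<in> carrier G" and h: "h \<in> H"
    have hG: "h \<in> carrier G" using h H.subset by blast
    have "g \<otimes> h \<otimes> inv g \<otimes> inv h \<in> derived G (carrier G)"
      using g hG unfolding derived_def by (blast intro: generate.incl)
    then have "(g \<otimes> h \<otimes> inv g \<otimes> inv h) \<otimes> h \<in> H" using assms(2) h by blast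
    then show "g \<otimes> h \<otimes> inv g \<in> H" using g hG by (simp add: m_assoc)
  qed
qed

lemma centralizer_mod_one:
  assumes "x \<in> carrier G"
  shows "centralizer_mod G {\<one>} x = centralizer G x"
  using assms by (auto simp: centralizer_mod_def centralizer_def commutator_eq_one_iff)

lemma centralizer_subgroup:
  assumes "x \<in> carrier G"
  shows "subgroup (centralizer G x) G"
  using centralizer_mod_subgroup[OF one_is_normal assms] centralizer_mod_one[OF assms] by simp

lemma centralizer_subset_centralizer_mod:
  assumes "N \<lhd> G" "x \<in> carrier G"
  shows "centralizer G x \<subseteq> centralizer_mod G N x"
  using subgroup.one_closed[OF normal_imp_subgroup[OF assms(1)]]
  by (auto simp: centralizer_mod_one[OF assms(2), symmetric] centralizer_mod_def)

section \<open>Perfectness of the derived subgroup\<close>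

lemma pseudocentral_normal_above_centralizer:
  assumes "pseudocentral G" "x \<in> carrier G" "H \<lhd> G" "centralizer G x \<subseteq> H"
  shows "H = carrier G"
proof
  show "H \<subseteq> carrier G" using assms(3) by (simp add: normal_imp_subgroup subgroup.subset)
  have "carrier G \<subseteq> normal_closure G (centralizer G x)"
    using assms(1,2) unfolding pseudocentral_def pseudocentre_def by blast
  then show "carrier G \<subseteq> H" using assms(3,4) unfolding normal_closure_def by blast
qed

text \<open>Lying above the derived subgroup makes \<open>centralizer_mod G N x\<close> normal, and
  it contains the centralizer of \<open>x\<close>; pseudocentrality then leaves only the whole
  group.\<close>

lemma pseudocentral_centralizer_mod:
  assumes "pseudocentral G" "x \<in> carrier G" "N \<lhd> G"
    and "derived G (carrier G) \<subseteq> centralizer_mod G N x"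
  shows "centralizer_mod G N x = carrier G"
  using assms(1,2)
proof (rule pseudocentral_normal_above_centralizer)
  show "centralizer_mod G N x \<lhd> G"
    using assms(2-4) by (simp add: subgroup_above_derived_normal centralizer_mod_subgroup)
  show "centralizer G x \<subseteq> centralizer_mod G N x"
    using assms(2,3) by (intro centralizer_subset_centralizer_mod)
qed

lemma pseudocentral_derived_perfect:
  assumes pc: "pseudocentral G"
  shows "derived G (derived G (carrier G)) = derived G (carrier G)"
proof
  let ?D = "derived G (carrier G)"
  let ?N = "derived G ?D"
  have D: "?D \<lhd> G" by (rule derived_self_is_normal)
  have N: "?N \<lhd> G" using D by (rule derived_is_normal)
  have DG: "?D \<subseteq> carrier G" using D by (simp add: normal_imp_subgroup subgroup.subset)
  have NS: "subgroup ?N G" using N by (rule normal_imp_subgroup)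
  \<comment> \<open>For \<open>x\<close> and \<open>g\<close> both in \<open>?D\<close>, [x, g] is
    one of the generators of \<open>?N\<close>.\<close>
  have step1: "centralizer_mod G ?N x = carrier G" if x: "x \<in> ?D" for x
  proof (rule pseudocentral_centralizer_mod[OF pc _ N])
    show "x \<in> carrier G" using x DG by blast
    show "?D \<subseteq> centralizer_mod G ?N x"
    proof
      fix g assume g: "g \<in> ?D"
      then have "x \<otimes> g \<otimes> inv x \<otimes> inv g \<in> ?N"
        unfolding derived_def[of G ?D] using x by (blast intro: generate.incl)
      then show "g \<in> centralizer_mod G ?N x" using g DG by (auto simp: centralizer_mod_def)
    qed
  qed
  have step2: "centralizer_mod G ?N x = carrier G" if x: "x \<in> carrier G" for x
  proof (rule pseudocentral_centralizer_mod[OF pc x N])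
    show "?D \<subseteq> centralizer_mod G ?N x"
    proof
      fix g assume g: "g \<in> ?D"
      then have gG: "g \<in> carrier G" using DG by blast
      \<comment> \<open>The roles are exchanged: \<open>step1\<close> is applied to
        \<open>g\<close>, and the inverse of [g, x] is [x, g].\<close>
      have "g \<otimes> x \<otimes> inv g \<otimes> inv x \<in> ?N"
        using step1[OF g] x by (auto simp: centralizer_mod_def)
      then have "inv (g \<otimes> x \<otimes> inv g \<otimes> inv x) \<in> ?N" by (rule subgroup.m_inv_closed[OF NS])
      then show "g \<in> centralizer_mod G ?N x"
        using x gG by (simp add: centralizer_mod_def inv_mult_group m_assoc)
    qed
  qed
  show "?D \<subseteq> ?N"
  proof (rule ord_eq_le_trans[OF derived_def generate_subgroup_incl[OF _ NS]])
    show "derived_set G (carrier G) \<subseteq> ?N"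
      using step2 by (auto simp: centralizer_mod_def)
  qed
  show "?N \<subseteq> ?D"
    using D by (simp add: derived_incl normal_imp_subgroup)
qed

section \<open>The centre and the second centre\<close>

lemma center_mod_iff:
  assumes "N \<lhd> G"
  shows "x \<in> center_mod G N \<longleftrightarrow> x \<in> carrier G \<and> centralizer_mod G N x = carrier G"
proof -
  interpret N: normal N G by fact
  \<comment> \<open>The cosets of xy and yx agree iff xy(yx)^-1 = [x, y] lies in \<open>N\<close>;
    this trades the quotient group for commutators.\<close>
  have eq: "N #> x <#> (N #> y) = N #> y <#> (N #> x) \<longleftrightarrow> y \<in> centralizer_mod G N x"
    if x: "x \<in> carrier G" and y: "y \<in> carrier G" for x y
  proof -
    have "N #> (x \<otimes> y) = N #> (y \<otimes> x) \<longleftrightarrow> x \<otimes> y \<in> N #> (y \<otimes> x)"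
      using x y rcos_self[OF _ N.subgroup_axioms] repr_independence[OF _ _ N.subgroup_axioms]
      by (metis m_closed)
    also have "\<dots> \<longleftrightarrow> x \<otimes> y \<otimes> inv (y \<otimes> x) \<in> N"
      using x y by (simp add: N.rcos_module)
    finally show ?thesis
      using x y by (simp add: N.rcos_sum centralizer_mod_def inv_mult_group m_assoc)
  qed
  have "x \<in> center_mod G N \<longleftrightarrow>
      x \<in> carrier G \<and> (\<forall>y\<in>carrier G. N #> x <#> (N #> y) = N #> y <#> (N #> x))"
    by (auto simp: center_mod_def center_def FactGroup_def RCOSETS_def)
  moreover have "centralizer_mod G N x \<subseteq> carrier G" by (auto simp: centralizer_mod_def)
  ultimately show ?thesis using eq by blast
qed

text \<open>Commutators lying in \<open>M\<close> lie in \<open>N\<close>. This carries a bound by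
  the centre through one step of a central series.\<close>

lemma center_mod_mono:
  assumes "M \<lhd> G" "N \<lhd> G" "M \<subseteq> N"
  shows "center_mod G M \<subseteq> center_mod G N"
  using assms unfolding center_mod_iff[OF assms(1)] center_mod_iff[OF assms(2)] subset_iff
  by (fastforce simp: centralizer_mod_def set_eq_iff)

lemma center_iff: "x \<in> center G \<longleftrightarrow> x \<in> carrier G \<and> centralizer G x = carrier G"
  unfolding center_def centralizer_def set_eq_iff mem_Collect_eq by metis

lemma center_mod_one: "center_mod G {\<one>} = center G"
  by (auto simp: center_mod_iff one_is_normal centralizer_mod_one center_iff)

lemma center_normal: "center G \<lhd> G"
  unfolding normal_inv_iff
proof (intro conjI ballI)
  have "center G = (\<Inter>x\<in>carrier G. centralizer G x)"
    by (auto simp: center_def centralizer_def)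
  also have "subgroup \<dots> G"
    by (rule subgroups_Inter) (auto intro: centralizer_subgroup)
  finally show "subgroup (center G) G" .
next
  fix x h assume x: "x \<in> carrier G" and h: "h \<in> center G"
  then have "h \<in> carrier G" "x \<otimes> h = h \<otimes> x" by (auto simp: center_def)
  then have "x \<otimes> h \<otimes> inv x = h" using x by (simp add: m_assoc)
  then show "x \<otimes> h \<otimes> inv x \<in> center G" using h by simp
qed

lemma upper_central_2: "upper_central G 2 = center_mod G (center G)"
  by (simp add: numeral_2_eq_2 center_mod_one)

lemma center_subset_center_mod_center: "center G \<subseteq> center_mod G (center G)"
  using center_mod_mono[OF one_is_normal center_normal]
    subgroup.one_closed[OF normal_imp_subgroup[OF center_normal]]
  by (simp add: center_mod_one)

text \<open>The kernel argument by direct computation: moving \<open>x\<close> past \<open>k\<close>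
  costs the central factor [x, k], and moving it past \<open>inv k\<close> cancels that factor. So
  conjugation by \<open>k\<close> preserves commuting with \<open>x\<close>.\<close>

lemma second_center_centralizer_normal:
  assumes "x \<in> center_mod G (center G)"
  shows "centralizer G x \<lhd> G"
proof -
  have x: "x \<in> carrier G" and xZ: "centralizer_mod G (center G) x = carrier G"
    using assms by (simp_all add: center_mod_iff center_normal)
  have "x \<otimes> (k \<otimes> g \<otimes> inv k) = k \<otimes> g \<otimes> inv k \<otimes> x"
    if k: "k \<in> carrier G" and g: "g \<in> carrier G" and xg: "x \<otimes> g = g \<otimes> x" for k g
  proof -
    define z where "z = x \<otimes> k \<otimes> inv x \<otimes> inv k"
    have "z \<in> center G" using k xZ by (auto simp: z_def centralizer_mod_def)
    then have z: "z \<in> carrier G" "\<And>y. y \<in> carrier G \<Longrightarrow> z \<otimes> y = y \<otimes> z"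
      by (auto simp: center_def)
    have xk: "x \<otimes> k = k \<otimes> x \<otimes> z"
      using x k z(1) by (simp add: z(2)[symmetric], simp add: z_def m_assoc)
    \<comment> \<open>Multiplying \<open>xk\<close> by \<open>inv k\<close> on both sides gives the
      rule \<open>kx\<close> for passing \<open>inv k\<close>, which absorbs
      \<open>z\<close>.\<close>
    then have "inv k \<otimes> (x \<otimes> k) \<otimes> inv k = inv k \<otimes> (k \<otimes> x \<otimes> z) \<otimes> inv k" by simp
    then have "x \<otimes> z \<otimes> inv k = inv k \<otimes> x"
      using x k z(1) by (simp add: m_assoc)
    then have kx: "x \<otimes> (z \<otimes> inv k) = inv k \<otimes> x" using x k z(1) by (simp add: m_assoc)
    have "x \<otimes> (k \<otimes> g \<otimes> inv k) = (x \<otimes> k) \<otimes> (g \<otimes> inv k)" using x k g by (simp add: m_assoc)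
    also have "\<dots> = k \<otimes> (x \<otimes> (z \<otimes> g)) \<otimes> inv k" using x k g z(1) by (simp add: xk m_assoc)
    also have "\<dots> = k \<otimes> ((x \<otimes> g) \<otimes> z) \<otimes> inv k" using x k g z by (simp add: m_assoc)
    also have "\<dots> = k \<otimes> g \<otimes> (x \<otimes> (z \<otimes> inv k))" using x k g z(1) by (simp add: xg m_assoc)
    also have "\<dots> = k \<otimes> g \<otimes> inv k \<otimes> x" using x k g by (simp add: kx m_assoc)
    finally show ?thesis .
  qed
  then show ?thesis
    unfolding normal_inv_iff using x centralizer_subgroup[OF x] by (simp add: centralizer_def)
qed

lemma pseudocentral_center_mod_center:
  assumes "pseudocentral G"
  shows "center_mod G (center G) = center G"
proof
  show "center_mod G (center G) \<subseteq> center G"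
  proof
    fix x assume x: "x \<in> center_mod G (center G)"
    then have xG: "x \<in> carrier G" by (simp add: center_mod_def)
    \<comment> \<open>The centralizer, being normal, serves as its own normal overgroup.\<close>
    have "centralizer G x = carrier G"
      using assms xG second_center_centralizer_normal[OF x] order_refl
      by (rule pseudocentral_normal_above_centralizer)
    then show "x \<in> center G" using xG by (simp add: center_iff)
  qed
  show "center G \<subseteq> center_mod G (center G)" by (rule center_subset_center_mod_center)
qed

section \<open>Commutativity from transfinite series\<close>

lemma derived_subset_commutator_subgroup:
  assumes "H \<subseteq> carrier G"
  shows "derived G H \<subseteq> commutator_subgroup G H (carrier G)"
  unfolding derived_def commutator_subgroup_def using assms by (intro mono_generate) blast

lemma comm_group_if_derived_trivial:
  assumes "derived G (carrier G) \<subseteq> {\<one>}"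
  shows "comm_group G"
proof (rule group_comm_groupI)
  fix x y assume xy: "x \<in> carrier G" "y \<in> carrier G"
  then have "x \<otimes> y \<otimes> inv x \<otimes> inv y \<in> derived G (carrier G)"
    unfolding derived_def by (blast intro: generate.incl)
  then show "x \<otimes> y = y \<otimes> x" using assms xy commutator_eq_one_iff by blast
qed

text \<open>The derived subgroup is below every term: it equals its own derived subgroup, so
  successor steps keep the inclusion by monotonicity, and so do intersections. A trivial term then
  makes it trivial.\<close>

lemma perfect_derived_hypoabelian_comm:
  assumes perfect: "derived G (derived G (carrier G)) = derived G (carrier G)"
    and "hypoabelian G"
  shows "comm_group G"
proof -
  obtain r :: "'a set rel" and S i
    where S: "derived_series G r S" and i: "i \<in> Field r" "S i = {\<one>}"
    using assms(2) unfolding hypoabelian_def by blast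
  have "derived G (carrier G) \<subseteq> S i"
    using S[unfolded derived_series_def] i(1)
  proof (induction rule: transfinite_series_induct)
    case start
    show ?case by (simp add: derived_in_carrier)
  next
    case (step A B)
    then show ?case using mono_derived[of "derived G (carrier G)" A] perfect by simp
  qed blast
  then show ?thesis using i(2) comm_group_if_derived_trivial by simp
qed

lemma perfect_derived_hypocentral_comm:
  assumes perfect: "derived G (derived G (carrier G)) = derived G (carrier G)"
    and "hypocentral G"
  shows "comm_group G"
proof -
  let ?D = "derived G (carrier G)"
  obtain r :: "'a set rel" and S i
    where S: "lower_central_series G r S" and i: "i \<in> Field r" "S i = {\<one>}"
    using assms(2) unfolding hypocentral_def by blast
  have "?D \<subseteq> S i"
    using S[unfolded lower_central_series_def] i(1)
  proof (induction rule: transfinite_series_induct)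
    case start
    show ?case by (simp add: derived_in_carrier)
  next
    case (step A B)
    \<comment> \<open>Perfectness enters as G' = [G', G'], which lies in [G', G]; the next inclusion
      is monotonicity of [_, G].\<close>
    have "?D \<subseteq> commutator_subgroup G ?D (carrier G)"
      using derived_subset_commutator_subgroup[of ?D] perfect by (simp add: derived_in_carrier)
    also have "\<dots> \<subseteq> commutator_subgroup G A (carrier G)"
      unfolding commutator_subgroup_def using step(1) by (intro mono_generate) blast
    finally show ?case using step(2) by simp
  qed blast
  then show ?thesis using i(2) comm_group_if_derived_trivial by simp
qed

lemma hypercentral_comm:
  assumes Z2: "center_mod G (center G) = center G"
    and "hypercentral G"
  shows "comm_group G"
proof -
  obtain r :: "'a set rel" and S i
    where S: "ascending_central_series G r S" and i: "i \<in> Field r" "S i = carrier G"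
    using assms(2) unfolding hypercentral_def by blast
  have "S i \<subseteq> center G"
    using S[unfolded ascending_central_series_def] i(1)
  proof (induction rule: transfinite_series_induct)
    case start
    show ?case by (simp add: center_def)
  next
    case (step A B)
    \<comment> \<open>The chain is: \<open>B\<close> lies in \<open>center_mod G A\<close>, hence in
      \<open>center_mod G (center G)\<close>, which is the centre by \<open>Z2\<close>.\<close>
    then show ?case using center_mod_mono[of A "center G"] center_normal Z2 by blast
  qed blast
  then show ?thesis
    using i(2) by (intro group_comm_groupI) (auto simp: center_def)
qed

end

theorem corollary2p27:
  fixes G :: "('a, 'b) monoid_scheme"
  assumes "group G"
    and "pseudocentral G"
  shows "derived G (carrier G) = derived G (derived G (carrier G))
    \<and> upper_central G 2 = center G
    \<and> (hypocentral G \<or> hypoabelian G \<or> hypercentral G \<longrightarrow> comm_group G)"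
proof -
  interpret group G by fact
  have "derived G (derived G (carrier G)) = derived G (carrier G)"
    using assms(2) by (rule pseudocentral_derived_perfect)
  moreover have "center_mod G (center G) = center G"
    using assms(2) by (rule pseudocentral_center_mod_center)
  ultimately show ?thesis
    using perfect_derived_hypocentral_comm perfect_derived_hypoabelian_comm hypercentral_comm
    by (simp add: upper_central_2)
qed

end
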